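(* Let $(A,\cdot,\circ)$ be an $L$-nilpotent skew brace of class $k$. Then $(A,\circ)$ is nilpotent of class at most $k$ and the $k$-th term in the lower central series of $(A,\circ)$ is contained in $\mathrm{Ann}(A)$.
   Context: A skew brace $(A,\cdot,\circ)$ is a set $A$ with two group structures such that $a\circ(b\cdot c)=(a\circ b)\cdot a^{-1}\cdot(a\circ c)$ for all $a,b,c\in A$, where $a^{-1}$ is the inverse of $a$ in $(A,\cdot)$. Define $L^1(A)=A$ and, inductively, let $L^{i+1}(A)$ be the subgroup of $(A,\cdot)$ generated by all elements $a*b:=a^{-1}\cdot(a\circ b)\cdot b^{-1}$ and $a\cdot b\cdot a^{-1}\cdot b^{-1}$ with $a\in A$, $b\in L^i(A)$. The skew brace is $L$-nilpotent if $L^{k+1}(A)=1$ for some $k\ge0$, and the minimal such $k$ is its $L$-nilpotency class. The annihilator is $\mathrm{Ann}(A)=\{a\in A: b\circ a=a\circ b=a\cdot b=b\cdot a\text{ for all }b\in A\}$. The lower central series of a group $G$ is indexed by $\gamma^1(G)=G$, $\gamma^{i+1}(G)=[G,\gamma^i(G)]$ (if $k=0$ then $A$ is trivial and the assertion on the $k$-th term is void). *)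

theory Defs
  imports "HOL-Algebra.Generated_Groups"
begin

text \<open>A skew brace \<open>(A, \<cdot>, \<circ>)\<close> is given by two group records on the same carrier:
  \<open>M\<close> is \<open>(A, \<cdot>)\<close> and \<open>C\<close> is \<open>(A, \<circ>)\<close>. The two units are not assumed to be equal;
  this follows from the compatibility condition.\<close>

locale skew_brace = M: group M + C: group C
  for M :: "('a, 'b) monoid_scheme" and C :: "('a, 'c) monoid_scheme" +
  assumes carrier_eq: "carrier C = carrier M"
    and compat: "\<lbrakk>a \<in> carrier M; b \<in> carrier M; c \<in> carrier M\<rbrakk> \<Longrightarrow>
      a \<otimes>\<^bsub>C\<^esub> (b \<otimes>\<^bsub>M\<^esub> c) = ((a \<otimes>\<^bsub>C\<^esub> b) \<otimes>\<^bsub>M\<^esub> inv\<^bsub>M\<^esub> a) \<otimes>\<^bsub>M\<^esub> (a \<otimes>\<^bsub>C\<^esub> c)"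

definition brace_star :: "('a, 'b) monoid_scheme \<Rightarrow> ('a, 'c) monoid_scheme \<Rightarrow> 'a \<Rightarrow> 'a \<Rightarrow> 'a" where
  "brace_star M C a b = (inv\<^bsub>M\<^esub> a \<otimes>\<^bsub>M\<^esub> (a \<otimes>\<^bsub>C\<^esub> b)) \<otimes>\<^bsub>M\<^esub> inv\<^bsub>M\<^esub> b"

definition group_commutator :: "('a, 'b) monoid_scheme \<Rightarrow> 'a \<Rightarrow> 'a \<Rightarrow> 'a" where
  "group_commutator G a b = a \<otimes>\<^bsub>G\<^esub> b \<otimes>\<^bsub>G\<^esub> inv\<^bsub>G\<^esub> a \<otimes>\<^bsub>G\<^esub> inv\<^bsub>G\<^esub> b"

text \<open>Both series below are indexed from 1; the value at index 0 is a dummy.\<close>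

fun L_series :: "('a, 'b) monoid_scheme \<Rightarrow> ('a, 'c) monoid_scheme \<Rightarrow> nat \<Rightarrow> 'a set" where
  "L_series M C 0 = carrier M"
| "L_series M C (Suc 0) = carrier M"
| "L_series M C (Suc (Suc i)) = generate M
     ({brace_star M C a b |a b. a \<in> carrier M \<and> b \<in> L_series M C (Suc i)} \<union>
      {group_commutator M a b |a b. a \<in> carrier M \<and> b \<in> L_series M C (Suc i)})"

definition L_nilpotent :: "('a, 'b) monoid_scheme \<Rightarrow> ('a, 'c) monoid_scheme \<Rightarrow> bool" where
  "L_nilpotent M C \<longleftrightarrow> (\<exists>k. L_series M C (k + 1) = {\<one>\<^bsub>M\<^esub>})"

text \<open>The classes \<open>L_class\<close> and \<open>nilpotency_class\<close> are meaningful only in the nilpotent case,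
  since \<open>LEAST\<close> is otherwise unspecified.\<close>

definition L_class :: "('a, 'b) monoid_scheme \<Rightarrow> ('a, 'c) monoid_scheme \<Rightarrow> nat" where
  "L_class M C = (LEAST k. L_series M C (k + 1) = {\<one>\<^bsub>M\<^esub>})"

definition Ann :: "('a, 'b) monoid_scheme \<Rightarrow> ('a, 'c) monoid_scheme \<Rightarrow> 'a set" where
  "Ann M C = {a \<in> carrier M. \<forall>b \<in> carrier M.
     b \<otimes>\<^bsub>C\<^esub> a = a \<otimes>\<^bsub>C\<^esub> b \<and> a \<otimes>\<^bsub>C\<^esub> b = a \<otimes>\<^bsub>M\<^esub> b \<and> a \<otimes>\<^bsub>M\<^esub> b = b \<otimes>\<^bsub>M\<^esub> a}"

fun lower_central_series :: "('a, 'b) monoid_scheme \<Rightarrow> nat \<Rightarrow> 'a set" where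
  "lower_central_series G 0 = carrier G"
| "lower_central_series G (Suc 0) = carrier G"
| "lower_central_series G (Suc (Suc i)) = generate G
     {group_commutator G a b |a b. a \<in> carrier G \<and> b \<in> lower_central_series G (Suc i)}"

definition nilpotent_group :: "('a, 'b) monoid_scheme \<Rightarrow> bool" where
  "nilpotent_group G \<longleftrightarrow> group G \<and> (\<exists>c. lower_central_series G (c + 1) = {\<one>\<^bsub>G\<^esub>})"

definition nilpotency_class :: "('a, 'b) monoid_scheme \<Rightarrow> nat" where
  "nilpotency_class G = (LEAST c. lower_central_series G (c + 1) = {\<one>\<^bsub>G\<^esub>})"

end

theory Submission
  imports Defs
begin

text \<open>
  Let \<open>\<lambda>\<^sub>a(b) = a\<^sup>-\<^sup>1 \<cdot> (a \<circ> b)\<close>. The map \<open>\<lambda>\<close> is an action of \<open>(A, \<circ>)\<close> on \<open>(A, \<cdot>)\<close> by automorphisms,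
  and \<open>a * b = \<lambda>\<^sub>a(b) \<cdot> b\<^sup>-\<^sup>1\<close>. Since the generators of \<open>L\<^sup>j\<^sup>+\<^sup>1\<close> are the elements
  \<open>a * b\<close> and the \<open>\<cdot>\<close>-commutators of \<open>a\<close> and \<open>b\<close> with \<open>b \<in> L\<^sup>j\<close>, the terms \<open>L\<^sup>j\<close> of the \<open>L\<close>-series are \<open>\<lambda>\<close>-invariant normal
  subgroups of \<open>(A, \<cdot>)\<close>, each \<open>L\<^sup>j / L\<^sup>j\<^sup>+\<^sup>1\<close> is central in \<open>A / L\<^sup>j\<^sup>+\<^sup>1\<close>, and \<open>(A, \<circ>)\<close> acts
  trivially on it: the action stabilises the \<open>L\<close>-series. As in the classical theorem on stability
  groups of normal series, the \<open>i\<close>-th lower central term \<open>\<gamma>\<^sup>i\<close> of \<open>(A, \<circ>)\<close> then moves elements by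
  \<open>i\<close> steps: \<open>\<gamma>\<^sup>i * L\<^sup>j \<subseteq> L\<^sup>i\<^sup>+\<^sup>j\<close> (\<open>lower_central_series_star_L_series\<close>).

  The terms \<open>L\<^sup>i\<close> need not be normal in \<open>(A, \<circ>)\<close>, so \<open>\<gamma>\<^sup>i \<subseteq> L\<^sup>i\<close> is not a formal consequence of the
  definitions. But if \<open>g\<close> is a \<open>\<circ>\<close>-commutator of \<open>a\<close> and \<open>c \<in> \<gamma>\<^sup>i \<subseteq> L\<^sup>i\<close>, then \<open>a \<circ> c\<close> and \<open>c \<circ> a\<close>
  agree modulo \<open>L\<^sup>i\<^sup>+\<^sup>1\<close>, as both agree with \<open>c \<cdot> a\<close>; and
  \<open>a \<circ> c = g \<circ> (c \<circ> a) = g \<cdot> \<lambda>\<^sub>g(c \<circ> a)\<close>, where \<open>\<lambda>\<^sub>g\<close> is trivial modulo \<open>L\<^sup>i\<^sup>+\<^sup>1\<close> by the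
  previous paragraph. So \<open>g \<in> L\<^sup>i\<^sup>+\<^sup>1\<close> (\<open>lower_central_series_subset_L_series\<close>).

  If the class is \<open>k\<close>, then \<open>\<gamma>\<^sup>k\<^sup>+\<^sup>1 \<subseteq> L\<^sup>k\<^sup>+\<^sup>1 = 1\<close>. Moreover, an element of \<open>\<gamma>\<^sup>k\<close> acts trivially because
  \<open>\<gamma>\<^sup>k * A \<subseteq> L\<^sup>k\<^sup>+\<^sup>1 = 1\<close>, and it is central in \<open>(A, \<cdot>)\<close> and fixed by \<open>\<lambda>\<close> because it lies in \<open>L\<^sup>k\<close>.
  These three properties say that it belongs to the annihilator.
\<close>

lemma (in group) inv_cancel_left:
  assumes "x \<in> carrier G" "y \<in> carrier G"
  shows "inv x \<otimes> (x \<otimes> y) = y" "x \<otimes> (inv x \<otimes> y) = y"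
  using assms by (simp_all flip: m_assoc)

context skew_brace
begin

section \<open>The lambda action\<close>

lemma one_eq: "\<one>\<^bsub>C\<^esub> = \<one>\<^bsub>M\<^esub>"
proof -
  let ?u = "\<one>\<^bsub>C\<^esub>"
  have u: "?u \<in> carrier M"
    using C.one_closed carrier_eq by simp
  have one: "?u \<otimes>\<^bsub>C\<^esub> \<one>\<^bsub>M\<^esub> = \<one>\<^bsub>M\<^esub>"
    by (simp add: carrier_eq)
  have "\<one>\<^bsub>M\<^esub> = inv\<^bsub>M\<^esub> ?u"
    using compat[OF u M.one_closed M.one_closed] u by (simp add: one)
  then have "inv\<^bsub>M\<^esub> \<one>\<^bsub>M\<^esub> = ?u"
    using u by (metis M.inv_inv)
  then show ?thesis by simp
qed

lemma circ_closed [simp, intro]: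
  "\<lbrakk>a \<in> carrier M; b \<in> carrier M\<rbrakk> \<Longrightarrow> a \<otimes>\<^bsub>C\<^esub> b \<in> carrier M"
  using C.m_closed carrier_eq by simp

lemma circ_inv_closed [simp, intro]: "a \<in> carrier M \<Longrightarrow> inv\<^bsub>C\<^esub> a \<in> carrier M"
  using C.inv_closed carrier_eq by simp

definition lam :: "'a \<Rightarrow> 'a \<Rightarrow> 'a" where
  "lam a b = inv\<^bsub>M\<^esub> a \<otimes>\<^bsub>M\<^esub> (a \<otimes>\<^bsub>C\<^esub> b)"

lemma lam_closed [simp, intro]:
  "\<lbrakk>a \<in> carrier M; b \<in> carrier M\<rbrakk> \<Longrightarrow> lam a b \<in> carrier M"
  by (simp add: lam_def)

lemma circ_eq_lam:
  "\<lbrakk>a \<in> carrier M; b \<in> carrier M\<rbrakk> \<Longrightarrow> a \<otimes>\<^bsub>C\<^esub> b = a \<otimes>\<^bsub>M\<^esub> lam a b"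
  by (simp add: lam_def M.inv_cancel_left)

lemma brace_star_eq_lam: "brace_star M C a b = lam a b \<otimes>\<^bsub>M\<^esub> inv\<^bsub>M\<^esub> b"
  by (simp add: brace_star_def lam_def)

lemma lam_eq_brace_star:
  assumes "a \<in> carrier M" "b \<in> carrier M"
  shows "lam a b = brace_star M C a b \<otimes>\<^bsub>M\<^esub> b"
  using assms by (simp add: brace_star_eq_lam M.m_assoc)

lemma brace_star_closed [simp, intro]:
  "\<lbrakk>a \<in> carrier M; b \<in> carrier M\<rbrakk> \<Longrightarrow> brace_star M C a b \<in> carrier M"
  by (simp add: brace_star_eq_lam)

lemma lam_mult:
  assumes "a \<in> carrier M" "b \<in> carrier M" "c \<in> carrier M"
  shows "lam a (b \<otimes>\<^bsub>M\<^esub> c) = lam a b \<otimes>\<^bsub>M\<^esub> lam a c"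
  using assms by (simp add: lam_def compat M.m_assoc)

lemma lam_one_right: "a \<in> carrier M \<Longrightarrow> lam a \<one>\<^bsub>M\<^esub> = \<one>\<^bsub>M\<^esub>"
  using C.r_one[of a, unfolded carrier_eq one_eq] by (simp add: lam_def)

lemma lam_inv:
  assumes "a \<in> carrier M" "b \<in> carrier M"
  shows "lam a (inv\<^bsub>M\<^esub> b) = inv\<^bsub>M\<^esub> (lam a b)"
proof -
  have "lam a (inv\<^bsub>M\<^esub> b) \<otimes>\<^bsub>M\<^esub> lam a b = \<one>\<^bsub>M\<^esub>"
    using assms by (simp add: lam_one_right flip: lam_mult)
  then show ?thesis
    using assms M.inv_equality by simp
qed

lemma lam_circ:
  assumes "a \<in> carrier M" "b \<in> carrier M" "c \<in> carrier M"
  shows "lam (a \<otimes>\<^bsub>C\<^esub> b) c = lam a (lam b c)"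
proof -
  have assoc: "a \<otimes>\<^bsub>C\<^esub> b \<otimes>\<^bsub>C\<^esub> c = a \<otimes>\<^bsub>C\<^esub> (b \<otimes>\<^bsub>C\<^esub> c)"
    using assms C.m_assoc carrier_eq by simp
  have "lam a (lam b c) = inv\<^bsub>M\<^esub> (lam a b) \<otimes>\<^bsub>M\<^esub> lam a (b \<otimes>\<^bsub>C\<^esub> c)"
    using assms by (simp add: lam_def[of b c] lam_mult lam_inv)
  also have "\<dots> = inv\<^bsub>M\<^esub> (a \<otimes>\<^bsub>C\<^esub> b) \<otimes>\<^bsub>M\<^esub> (a \<otimes>\<^bsub>C\<^esub> (b \<otimes>\<^bsub>C\<^esub> c))"
    using assms by (simp add: lam_def M.inv_mult_group M.m_assoc M.inv_cancel_left)
  finally show ?thesis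
    by (simp add: lam_def[of "a \<otimes>\<^bsub>C\<^esub> b"] assoc)
qed

lemma lam_one_left: "b \<in> carrier M \<Longrightarrow> lam \<one>\<^bsub>M\<^esub> b = b"
  using C.l_one[of b, unfolded carrier_eq one_eq] by (simp add: lam_def)

lemma lam_circ_inv:
  assumes "a \<in> carrier M" "b \<in> carrier M"
  shows "lam a (lam (inv\<^bsub>C\<^esub> a) b) = b"
  using assms C.r_inv carrier_eq one_eq lam_one_left by (simp flip: lam_circ)

section \<open>The L-series\<close>

lemma subgroup_L_series: "subgroup (L_series M C i) M"
proof (induction i rule: induct_nat_012)
  case (ge2 i)
  then show ?case
    unfolding L_series.simps
    by (intro M.generate_is_subgroup)
      (auto simp: group_commutator_def dest: subgroup.mem_carrier)
qed (auto intro: M.subgroup_self)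

lemmas L_series_mem_carrier = subgroup.mem_carrier[OF subgroup_L_series]
  and L_series_mult = subgroup.m_closed[OF subgroup_L_series]
  and L_series_inv = subgroup.m_inv_closed[OF subgroup_L_series]

lemma brace_star_mem_L_series:
  assumes "a \<in> carrier M" "b \<in> L_series M C i" "i \<ge> 1"
  shows "brace_star M C a b \<in> L_series M C (Suc i)"
  using assms by (cases i) (auto intro!: generate.incl)

lemma group_commutator_mem_L_series:
  assumes "a \<in> carrier M" "b \<in> L_series M C i" "i \<ge> 1"
  shows "group_commutator M a b \<in> L_series M C (Suc i)"
  using assms by (cases i) (auto intro!: generate.incl)

lemma L_series_Suc_subset: "L_series M C (Suc i) \<subseteq> L_series M C i"
proof (induction i)
  case 0
  then show ?case by simp
next
  case (Suc i)
  show ?case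
  proof (cases i)
    case 0
    then show ?thesis
      using subgroup.subset[OF subgroup_L_series, of "Suc (Suc 0)"] by simp
  next
    case (Suc j)
    then show ?thesis
      using \<open>L_series M C (Suc i) \<subseteq> L_series M C i\<close>
      unfolding \<open>i = Suc j\<close> L_series.simps(3)[of M C j] L_series.simps(3)[of M C "Suc j"]
      by (intro M.mono_generate) blast
  qed
qed

lemma lam_mem_L_series:
  assumes "a \<in> carrier M" "b \<in> L_series M C i" "i \<ge> 1"
  shows "lam a b \<in> L_series M C i"
proof -
  have "brace_star M C a b \<in> L_series M C i"
    using brace_star_mem_L_series[OF assms] L_series_Suc_subset by blast
  then show ?thesis
    using assms by (simp add: lam_eq_brace_star L_series_mem_carrier L_series_mult)
qed

lemma conj_mem_L_series:
  assumes "a \<in> carrier M" "b \<in> L_series M C i" "i \<ge> 1"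
  shows "a \<otimes>\<^bsub>M\<^esub> b \<otimes>\<^bsub>M\<^esub> inv\<^bsub>M\<^esub> a \<in> L_series M C i"
proof -
  have "group_commutator M a b \<in> L_series M C i"
    using group_commutator_mem_L_series[OF assms] L_series_Suc_subset by blast
  moreover have "a \<otimes>\<^bsub>M\<^esub> b \<otimes>\<^bsub>M\<^esub> inv\<^bsub>M\<^esub> a = group_commutator M a b \<otimes>\<^bsub>M\<^esub> b"
    using assms L_series_mem_carrier
    by (simp add: group_commutator_def M.m_assoc)
  ultimately show ?thesis
    using assms by (simp add: L_series_mult)
qed

text \<open>A subgroup of \<open>(A, \<cdot>)\<close> invariant under \<open>\<lambda>\<close> is also a subgroup of \<open>(A, \<circ>)\<close>, because
  \<open>a \<circ> b = a \<cdot> \<lambda>\<^sub>a(b)\<close> and the \<open>\<circ>\<close>-inverse \<open>a'\<close> of \<open>a\<close> is \<open>\<lambda>\<^sub>a\<^sub>'(a)\<^sup>-\<^sup>1\<close>.\<close>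

lemma subgroup_circ_L_series:
  assumes "i \<ge> 1"
  shows "subgroup (L_series M C i) C"
proof (rule C.subgroupI)
  show "L_series M C i \<subseteq> carrier C"
    using L_series_mem_carrier carrier_eq by auto
  show "L_series M C i \<noteq> {}"
    using subgroup.one_closed[OF subgroup_L_series] by blast
next
  fix a assume a: "a \<in> L_series M C i"
  then have aM: "a \<in> carrier M"
    by (rule L_series_mem_carrier)
  have "inv\<^bsub>C\<^esub> a \<otimes>\<^bsub>M\<^esub> lam (inv\<^bsub>C\<^esub> a) a = \<one>\<^bsub>M\<^esub>"
    using aM C.l_inv carrier_eq one_eq by (simp flip: circ_eq_lam)
  then have "inv\<^bsub>C\<^esub> a = inv\<^bsub>M\<^esub> (lam (inv\<^bsub>C\<^esub> a) a)"
    using aM by (metis M.inv_equality circ_inv_closed lam_closed)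
  then show "inv\<^bsub>C\<^esub> a \<in> L_series M C i"
    using a aM assms by (metis L_series_inv circ_inv_closed lam_mem_L_series)
next
  fix a b assume ab: "a \<in> L_series M C i" "b \<in> L_series M C i"
  then show "a \<otimes>\<^bsub>C\<^esub> b \<in> L_series M C i"
    using assms by (simp add: circ_eq_lam L_series_mem_carrier L_series_mult lam_mem_L_series)
qed

section \<open>Elements that act trivially up to a shift of the L-series\<close>

text \<open>The condition ranges over all \<open>j\<close> at once because the step from \<open>c\<close> to a \<open>\<circ>\<close>-commutator with
  \<open>c\<close> uses it for \<open>c\<close> at two depths, \<open>L\<^sup>j\<close> and \<open>L\<^sup>j\<^sup>+\<^sup>1\<close>. As the set is a subgroup of \<open>(A, \<circ>)\<close>,
  membership of a whole lower central term can be tested on commutators.\<close>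

definition star_shift :: "nat \<Rightarrow> 'a set" where
  "star_shift i = {c \<in> carrier M.
     \<forall>j\<ge>1. \<forall>x\<in>L_series M C j. brace_star M C c x \<in> L_series M C (i + j)}"

lemma star_shiftD:
  assumes "c \<in> star_shift i"
  shows "c \<in> carrier M"
    and "\<lbrakk>x \<in> L_series M C j; j \<ge> 1\<rbrakk> \<Longrightarrow> brace_star M C c x \<in> L_series M C (i + j)"
  using assms by (auto simp: star_shift_def)

lemma subgroup_star_shift: "subgroup (star_shift i) C"
proof (rule C.subgroupI)
  show "star_shift i \<subseteq> carrier C"
    by (auto simp: star_shift_def carrier_eq)
  have "\<one>\<^bsub>M\<^esub> \<in> star_shift i"
    using subgroup.one_closed[OF subgroup_L_series]
    by (auto simp: star_shift_def brace_star_eq_lam lam_one_left L_series_mem_carrier)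
  then show "star_shift i \<noteq> {}" by blast
next
  fix c assume c: "c \<in> star_shift i"
  note cM = star_shiftD(1)[OF c]
  have "brace_star M C (inv\<^bsub>C\<^esub> c) x \<in> L_series M C (i + j)"
    if x: "x \<in> L_series M C j" and j: "j \<ge> 1" for x j
  proof -
    let ?y = "lam (inv\<^bsub>C\<^esub> c) x"
    have xM: "x \<in> carrier M"
      using x by (rule L_series_mem_carrier)
    have "brace_star M C c ?y \<in> L_series M C (i + j)"
      using star_shiftD(2)[OF c] lam_mem_L_series x j cM by blast
    then have "inv\<^bsub>M\<^esub> (brace_star M C c ?y) \<in> L_series M C (i + j)"
      by (rule L_series_inv)
    also have "inv\<^bsub>M\<^esub> (brace_star M C c ?y) = brace_star M C (inv\<^bsub>C\<^esub> c) x"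
      using cM xM by (simp add: brace_star_eq_lam lam_circ_inv M.inv_mult_group)
    finally show ?thesis .
  qed
  then show "inv\<^bsub>C\<^esub> c \<in> star_shift i"
    using cM by (auto simp: star_shift_def)
next
  fix c d assume c: "c \<in> star_shift i" and d: "d \<in> star_shift i"
  note cM = star_shiftD(1)[OF c] and dM = star_shiftD(1)[OF d]
  have "brace_star M C (c \<otimes>\<^bsub>C\<^esub> d) x \<in> L_series M C (i + j)"
    if x: "x \<in> L_series M C j" and j: "j \<ge> 1" for x j
  proof -
    let ?y = "lam d x"
    have xM: "x \<in> carrier M"
      using x by (rule L_series_mem_carrier)
    have "brace_star M C c ?y \<otimes>\<^bsub>M\<^esub> brace_star M C d x \<in> L_series M C (i + j)"
      using star_shiftD(2)[OF c] star_shiftD(2)[OF d] lam_mem_L_series x j dM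
      by (intro L_series_mult) auto
    also have "brace_star M C c ?y \<otimes>\<^bsub>M\<^esub> brace_star M C d x = brace_star M C (c \<otimes>\<^bsub>C\<^esub> d) x"
      using cM dM xM
      by (simp add: brace_star_eq_lam lam_circ M.m_assoc M.inv_cancel_left)
    finally show ?thesis .
  qed
  then show "c \<otimes>\<^bsub>C\<^esub> d \<in> star_shift i"
    using cM dM by (auto simp: star_shift_def)
qed

lemma circ_commutator_swap:
  assumes "a \<in> carrier M" "c \<in> carrier M"
  shows "group_commutator C a c \<in> carrier M"
    and "group_commutator C a c \<otimes>\<^bsub>C\<^esub> (c \<otimes>\<^bsub>C\<^esub> a) = a \<otimes>\<^bsub>C\<^esub> c"
proof -
  have "a \<in> carrier C" "c \<in> carrier C"
    using assms carrier_eq by auto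
  then show "group_commutator C a c \<otimes>\<^bsub>C\<^esub> (c \<otimes>\<^bsub>C\<^esub> a) = a \<otimes>\<^bsub>C\<^esub> c"
    by (simp add: group_commutator_def C.m_assoc C.inv_cancel_left)
  show "group_commutator C a c \<in> carrier M"
    using assms by (simp add: group_commutator_def)
qed

text \<open>Let \<open>g\<close> be the \<open>\<circ>\<close>-commutator of \<open>a\<close> and \<open>c\<close>, and put \<open>x = \<lambda>\<^sub>c\<lambda>\<^sub>a(y)\<close>, so that
  \<open>\<lambda>\<^sub>g(x) = \<lambda>\<^sub>a\<lambda>\<^sub>c(y)\<close>. With \<open>\<lambda>\<^sub>c(y) = u \<cdot> y\<close> and
  \<open>\<lambda>\<^sub>a(y) = v \<cdot> y\<close>, the element \<open>g * x\<close> is \<open>\<lambda>\<^sub>a(u) \<cdot> v \<cdot> u\<^sup>-\<^sup>1 \<cdot> \<lambda>\<^sub>c(v)\<^sup>-\<^sup>1\<close>. Both \<open>\<lambda>\<^sub>a(u)\<close>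
  and \<open>\<lambda>\<^sub>c(v)\<close> differ from \<open>u\<close> and \<open>v\<close> by a factor in \<open>L\<^sup>i\<^sup>+\<^sup>j\<^sup>+\<^sup>1\<close> only,
  which leaves the \<open>\<cdot>\<close>-commutator of \<open>u \<in> L\<^sup>i\<^sup>+\<^sup>j\<close> and \<open>v\<close>;
  this lies in \<open>L\<^sup>i\<^sup>+\<^sup>j\<^sup>+\<^sup>1\<close> too, as the \<open>L\<close>-series is central in \<open>(A, \<cdot>)\<close>.\<close>

lemma circ_commutator_mem_star_shift:
  assumes a: "a \<in> carrier M" and c: "c \<in> star_shift i"
  shows "group_commutator C a c \<in> star_shift (Suc i)"
proof -
  let ?g = "group_commutator C a c"
  note cM = star_shiftD(1)[OF c]
  note g = circ_commutator_swap[OF a cM]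
  have "brace_star M C ?g x \<in> L_series M C (Suc (i + j))"
    if x: "x \<in> L_series M C j" and j: "j \<ge> 1" for x j
  proof -
    define y where "y = lam (inv\<^bsub>C\<^esub> (c \<otimes>\<^bsub>C\<^esub> a)) x"
    have xM: "x \<in> carrier M"
      using x by (rule L_series_mem_carrier)
    have y: "y \<in> L_series M C j"
      unfolding y_def using x j a cM by (intro lam_mem_L_series circ_inv_closed circ_closed)
    then have yM: "y \<in> carrier M"
      by (rule L_series_mem_carrier)
    have x_eq: "x = lam c (lam a y)"
      using lam_circ_inv[of "c \<otimes>\<^bsub>C\<^esub> a" x] lam_circ[of c a y] a cM xM yM
      by (simp flip: y_def)
    have gx_eq: "lam ?g x = lam a (lam c y)"
      using a cM yM g by (simp add: x_eq flip: lam_circ)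

    define u where "u = brace_star M C c y"
    define v where "v = brace_star M C a y"
    have u: "u \<in> L_series M C (i + j)"
      unfolding u_def using star_shiftD(2)[OF c] y j by blast
    have v: "v \<in> L_series M C (Suc j)"
      unfolding v_def using brace_star_mem_L_series a y j by blast
    have uM: "u \<in> carrier M" and vM: "v \<in> carrier M"
      using u v L_series_mem_carrier by blast+
    let ?p = "brace_star M C a u" and ?q = "brace_star M C c v"
    have p: "?p \<in> L_series M C (Suc (i + j))"
      using brace_star_mem_L_series a u j by simp
    have q: "?q \<in> L_series M C (Suc (i + j))"
      using star_shiftD(2)[OF c v] by simp
    have w: "group_commutator M v u \<in> L_series M C (Suc (i + j))"
      using group_commutator_mem_L_series vM u j by simp

    have gx: "lam ?g x = ?p \<otimes>\<^bsub>M\<^esub> u \<otimes>\<^bsub>M\<^esub> v \<otimes>\<^bsub>M\<^esub> y"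
      using a cM uM vM yM
      by (simp add: gx_eq lam_eq_brace_star[of c y] lam_mult lam_eq_brace_star[of a]
          M.m_assoc flip: u_def v_def)
    have x': "x = ?q \<otimes>\<^bsub>M\<^esub> v \<otimes>\<^bsub>M\<^esub> u \<otimes>\<^bsub>M\<^esub> y"
      using a cM uM vM yM
      by (simp add: x_eq lam_eq_brace_star[of a y] lam_mult lam_eq_brace_star[of c]
          M.m_assoc flip: u_def v_def)
    have "brace_star M C ?g x = (?p \<otimes>\<^bsub>M\<^esub> u \<otimes>\<^bsub>M\<^esub> v \<otimes>\<^bsub>M\<^esub> y) \<otimes>\<^bsub>M\<^esub> inv\<^bsub>M\<^esub> (?q \<otimes>\<^bsub>M\<^esub> v \<otimes>\<^bsub>M\<^esub> u \<otimes>\<^bsub>M\<^esub> y)"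
      by (simp only: brace_star_eq_lam[of ?g] gx flip: x')
    also have "\<dots> = ?p \<otimes>\<^bsub>M\<^esub> inv\<^bsub>M\<^esub> (group_commutator M v u) \<otimes>\<^bsub>M\<^esub> inv\<^bsub>M\<^esub> ?q"
      using a cM uM vM yM
      by (simp add: group_commutator_def[of M] M.inv_mult_group M.m_assoc M.inv_cancel_left)
    finally have "brace_star M C ?g x = ?p \<otimes>\<^bsub>M\<^esub> inv\<^bsub>M\<^esub> (group_commutator M v u) \<otimes>\<^bsub>M\<^esub> inv\<^bsub>M\<^esub> ?q" .
    then show ?thesis
      using p q w by (simp add: L_series_mult L_series_inv)
  qed
  then show ?thesis
    using g by (auto simp: star_shift_def)
qed

section \<open>The lower central series of the circle group\<close>

lemma lower_central_series_star_L_series: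
  "lower_central_series C (Suc i) \<subseteq> star_shift (Suc i)"
proof (induction i)
  case 0
  show ?case
    using brace_star_mem_L_series by (auto simp: star_shift_def carrier_eq)
next
  case (Suc i)
  show ?case
    unfolding lower_central_series.simps
    using Suc circ_commutator_mem_star_shift carrier_eq
    by (intro C.generate_subgroup_incl[OF _ subgroup_star_shift]) auto
qed

text \<open>The hypothesis that the commutator \<open>g\<close> acts trivially modulo \<open>L\<^sup>i\<^sup>+\<^sup>1\<close> replaces the normality of
  \<open>L\<^sup>i\<^sup>+\<^sup>1\<close> in \<open>(A, \<circ>)\<close>: it lets the congruence \<open>g \<circ> (c \<circ> a) = a \<circ> c \<equiv> c \<circ> a\<close> be cancelled
  inside \<open>(A, \<cdot>)\<close>.\<close>

lemma circ_commutator_mem_L_series: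
  assumes a: "a \<in> carrier M" and c: "c \<in> L_series M C i" and i: "i \<ge> 1"
    and c_star: "brace_star M C c a \<in> L_series M C (Suc i)"
    and g_star: "\<And>d. d \<in> carrier M \<Longrightarrow>
      brace_star M C (group_commutator C a c) d \<in> L_series M C (Suc i)"
  shows "group_commutator C a c \<in> L_series M C (Suc i)"
proof -
  let ?L = "L_series M C (Suc i)"
  let ?g = "group_commutator C a c"
  have cM: "c \<in> carrier M"
    using c by (rule L_series_mem_carrier)
  note g = circ_commutator_swap[OF a cM]
  let ?d = "c \<otimes>\<^bsub>C\<^esub> a"
  let ?p = "brace_star M C a c" and ?q = "brace_star M C c a" and ?r = "brace_star M C ?g ?d"
  let ?P = "a \<otimes>\<^bsub>M\<^esub> ?p \<otimes>\<^bsub>M\<^esub> inv\<^bsub>M\<^esub> a" and ?Q = "c \<otimes>\<^bsub>M\<^esub> ?q \<otimes>\<^bsub>M\<^esub> inv\<^bsub>M\<^esub> c"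
  let ?w = "group_commutator M a c"
  have mem: "?P \<in> ?L" "?Q \<in> ?L" "?w \<in> ?L" "?r \<in> ?L"
    using a c cM i c_star g_star
    by (auto intro!: conj_mem_L_series brace_star_mem_L_series group_commutator_mem_L_series)
  note memM = mem[THEN L_series_mem_carrier]
  have d: "?d = ?Q \<otimes>\<^bsub>M\<^esub> (c \<otimes>\<^bsub>M\<^esub> a)"
    using a cM by (simp add: circ_eq_lam lam_eq_brace_star M.m_assoc M.inv_cancel_left)
  have ac: "a \<otimes>\<^bsub>C\<^esub> c = ?P \<otimes>\<^bsub>M\<^esub> ?w \<otimes>\<^bsub>M\<^esub> (c \<otimes>\<^bsub>M\<^esub> a)"
    using a cM by (simp add: circ_eq_lam lam_eq_brace_star group_commutator_def M.m_assoc
        M.inv_cancel_left)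
  have "?g \<otimes>\<^bsub>M\<^esub> ?r \<otimes>\<^bsub>M\<^esub> ?Q \<otimes>\<^bsub>M\<^esub> (c \<otimes>\<^bsub>M\<^esub> a) = ?g \<otimes>\<^bsub>M\<^esub> ?r \<otimes>\<^bsub>M\<^esub> ?d"
    using a cM g(1) memM by (simp only: d M.m_assoc M.m_closed)
  also have "\<dots> = ?g \<otimes>\<^bsub>C\<^esub> ?d"
    using a cM g(1) by (simp add: circ_eq_lam[of ?g] lam_eq_brace_star[of ?g] M.m_assoc)
  also have "\<dots> = ?P \<otimes>\<^bsub>M\<^esub> ?w \<otimes>\<^bsub>M\<^esub> (c \<otimes>\<^bsub>M\<^esub> a)"
    by (simp only: g(2) ac)
  finally have "?g \<otimes>\<^bsub>M\<^esub> ?r \<otimes>\<^bsub>M\<^esub> ?Q = ?P \<otimes>\<^bsub>M\<^esub> ?w"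
    using a cM g(1) memM by (simp only: M.right_cancel M.m_closed)
  then have "?g \<otimes>\<^bsub>M\<^esub> (?r \<otimes>\<^bsub>M\<^esub> ?Q) = ?P \<otimes>\<^bsub>M\<^esub> ?w"
    using g(1) memM by (simp only: M.m_assoc)
  then have "?g = ?P \<otimes>\<^bsub>M\<^esub> ?w \<otimes>\<^bsub>M\<^esub> inv\<^bsub>M\<^esub> (?r \<otimes>\<^bsub>M\<^esub> ?Q)"
    using g(1) memM by (metis M.inv_solve_right M.m_closed)
  then show ?thesis
    using mem by (metis L_series_mult L_series_inv)
qed

lemma lower_central_series_subset_L_series:
  "lower_central_series C (Suc i) \<subseteq> L_series M C (Suc i)"
proof (induction i)
  case 0
  show ?case by (simp add: carrier_eq)
next
  case (Suc i)
  have "group_commutator C a c \<in> L_series M C (Suc (Suc i))"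
    if a: "a \<in> carrier M" and c: "c \<in> lower_central_series C (Suc i)" for a c
  proof (rule circ_commutator_mem_L_series[OF a])
    have shift: "c \<in> star_shift (Suc i)"
      using c lower_central_series_star_L_series by blast
    show "c \<in> L_series M C (Suc i)"
      using c Suc by blast
    show "brace_star M C c a \<in> L_series M C (Suc (Suc i))"
      using star_shiftD(2)[OF shift, of a 1] a by simp
    show "brace_star M C (group_commutator C a c) d \<in> L_series M C (Suc (Suc i))"
      if "d \<in> carrier M" for d
      using star_shiftD(2)[OF circ_commutator_mem_star_shift[OF a shift], of d 1] that
      by (intro subsetD[OF L_series_Suc_subset[of "Suc (Suc i)"]]) simp
  qed simp
  then show ?case
    unfolding lower_central_series.simps
    using carrier_eq
    by (intro C.generate_subgroup_incl[OF _ subgroup_circ_L_series]) auto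
qed

lemma lower_central_series_subset_Ann:
  assumes k: "k \<ge> 1" and triv: "L_series M C (Suc k) = {\<one>\<^bsub>M\<^esub>}"
  shows "lower_central_series C k \<subseteq> Ann M C"
proof
  fix z assume z: "z \<in> lower_central_series C k"
  obtain i where i: "k = Suc i"
    using k by (cases k) auto
  have shift: "z \<in> star_shift k" and zL: "z \<in> L_series M C k"
    using z lower_central_series_star_L_series lower_central_series_subset_L_series
    unfolding i by blast+
  have zM: "z \<in> carrier M"
    using zL by (rule L_series_mem_carrier)
  have "b \<otimes>\<^bsub>C\<^esub> z = z \<otimes>\<^bsub>C\<^esub> b \<and> z \<otimes>\<^bsub>C\<^esub> b = z \<otimes>\<^bsub>M\<^esub> b \<and> z \<otimes>\<^bsub>M\<^esub> b = b \<otimes>\<^bsub>M\<^esub> z"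
    if b: "b \<in> carrier M" for b
  proof -
    have "brace_star M C b z = \<one>\<^bsub>M\<^esub>"
      using brace_star_mem_L_series[OF b zL k] triv by simp
    then have bz: "b \<otimes>\<^bsub>C\<^esub> z = b \<otimes>\<^bsub>M\<^esub> z"
      using b zM by (simp add: circ_eq_lam lam_eq_brace_star)
    have "brace_star M C z b = \<one>\<^bsub>M\<^esub>"
      using star_shiftD(2)[OF shift, of b 1] b triv by simp
    then have zb: "z \<otimes>\<^bsub>C\<^esub> b = z \<otimes>\<^bsub>M\<^esub> b"
      using b zM by (simp add: circ_eq_lam lam_eq_brace_star)
    have "group_commutator M b z = \<one>\<^bsub>M\<^esub>"
      using group_commutator_mem_L_series[OF b zL k] triv by simp
    moreover have "b \<otimes>\<^bsub>M\<^esub> z = group_commutator M b z \<otimes>\<^bsub>M\<^esub> (z \<otimes>\<^bsub>M\<^esub> b)"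
      using b zM by (simp add: group_commutator_def M.m_assoc M.inv_cancel_left)
    ultimately have "b \<otimes>\<^bsub>M\<^esub> z = z \<otimes>\<^bsub>M\<^esub> b"
      using b zM by simp
    then show ?thesis
      by (simp add: bz zb)
  qed
  then show "z \<in> Ann M C"
    using zM by (simp add: Ann_def)
qed

lemma one_mem_lower_central_series: "\<one>\<^bsub>C\<^esub> \<in> lower_central_series C i"
  by (cases "(C, i)" rule: lower_central_series.cases) (auto intro: generate.one)

end

theorem theorem4p12:
  fixes M :: "('a, 'b) monoid_scheme" and C :: "('a, 'c) monoid_scheme" and k :: nat
  assumes "skew_brace M C"
    and "L_nilpotent M C"
    and "L_class M C = k"
  shows "nilpotent_group C \<and> nilpotency_class C \<le> k \<and>
    (k \<ge> 1 \<longrightarrow> lower_central_series C k \<subseteq> Ann M C)"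
proof -
  interpret skew_brace M C by fact
  have triv: "L_series M C (Suc k) = {\<one>\<^bsub>M\<^esub>}"
    using assms(2,3) LeastI_ex[of "\<lambda>k. L_series M C (k + 1) = {\<one>\<^bsub>M\<^esub>}"]
    by (simp add: L_nilpotent_def L_class_def)
  have lcs: "lower_central_series C (k + 1) = {\<one>\<^bsub>C\<^esub>}"
    using lower_central_series_subset_L_series[of k] triv one_eq
      one_mem_lower_central_series[of "k + 1"] by auto
  then have "nilpotent_group C"
    using C.group_axioms by (auto simp: nilpotent_group_def)
  moreover have "nilpotency_class C \<le> k"
    unfolding nilpotency_class_def using lcs by (rule Least_le)
  ultimately show ?thesis
    using lower_central_series_subset_Ann triv by blast
qed

end
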